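(* Let $\Gamma$ be a countable discrete group and let $\Gamma\rtimes_\theta\mathbb{Z}$ be a semi-direct product with respect to $\theta\in\operatorname{Aut}(\Gamma)$. Let $\phi:\Gamma\rtimes_\theta\mathbb{Z}\curvearrowright X$ be an action on a (nonempty) totally disconnected locally compact Hausdorff space $X$. Suppose that the restricted action $\phi:\Gamma\curvearrowright X$ is minimal and $H^1$-rigid. Then $\phi:\Gamma\rtimes_\theta\mathbb{Z}\curvearrowright X$ is also $H^1$-rigid.
   Context: An action $G\curvearrowright X$ is minimal if every orbit is dense in $X$. For an action of a discrete group $G$ on $X$, the transformation groupoid $X\rtimes G$ is $X\times G$ with the product topology, unit space $X$ (identified with $X\times\{1\}$), $r(x,\gamma)=x$, $s(x,\gamma)=\gamma^{-1}x$, $(x,\gamma)(\gamma^{-1}x,\gamma')=(x,\gamma\gamma')$; the natural homomorphism $\pi:X\rtimes G\to G$ is $\pi(x,\gamma)=\gamma$. For such a groupoid $\mathcal{G}$, $H^1(\mathcal{G})=H^1(\mathcal{G},\mathbb{Z})$ is the group of continuous homomorphisms $\xi:\mathcal{G}\to\mathbb{Z}$ modulo coboundaries, i.e. homomorphisms of the form $g\mapsto f(r(g))-f(s(g))$ with $f:\mathcal{G}^{(0)}\to\mathbb{Z}$ continuous. A homomorphism $\pi$ induces $H^1(\pi):[\xi]\mapsto[\xi\circ\pi]$. An action $G\curvearrowright X$ of a countable discrete group on a totally disconnected locally compact Hausdorff space is $H^1$-rigid if $H^1(\pi):\operatorname{Hom}(G,\mathbb{Z})=H^1(G)\to H^1(X\rtimes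 G)$ is an isomorphism. *)

theory Defs
  imports
    "HOL-Analysis.Abstract_Topological_Spaces"
    "HOL-Algebra.Group_Action"
    "HOL-Algebra.Elementary_Groups"
    "HOL-Library.Countable_Set"
begin

section \<open>Actions of discrete groups on topological spaces\<close>

definition totally_disconnected_space :: "'x topology \<Rightarrow> bool"
  where "totally_disconnected_space X \<longleftrightarrow>
    (\<forall>S. connectedin X S \<longrightarrow> (\<exists>a. S \<subseteq> {a}))"

text \<open>The acting group is discrete, so joint continuity of the action map amounts to continuity of
  each of the maps \<open>\<phi> g\<close>.\<close>

definition continuous_action ::
    "('g, 'm) monoid_scheme \<Rightarrow> 'x topology \<Rightarrow> ('g \<Rightarrow> 'x \<Rightarrow> 'x) \<Rightarrow> bool"
  where "continuous_action G X \<phi> \<longleftrightarrow>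
    group_action G (topspace X) \<phi> \<and> (\<forall>g\<in>carrier G. continuous_map X X (\<phi> g))"

definition minimal_action ::
    "('g, 'm) monoid_scheme \<Rightarrow> 'x topology \<Rightarrow> ('g \<Rightarrow> 'x \<Rightarrow> 'x) \<Rightarrow> bool"
  where "minimal_action G X \<phi> \<longleftrightarrow>
    (\<forall>x\<in>topspace X. X closure_of (orbit G \<phi> x) = topspace X)"


section \<open>Topological groupoids and their first cohomology\<close>

text \<open>The unit space is kept as a space of its own, with \<open>range_map\<close> and \<open>source_map\<close> taking values
  in it. The product of \<open>g\<close> and \<open>h\<close> is meaningful only if \<open>source_map g = range_map h\<close>. Units and
  inverses are determined by the product and are not recorded.\<close>

record ('a, 'u) top_groupoid =
  arrows :: "'a topology"
  unit_space :: "'u topology"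
  range_map :: "'a \<Rightarrow> 'u"
  source_map :: "'a \<Rightarrow> 'u"
  arrow_comp :: "'a \<Rightarrow> 'a \<Rightarrow> 'a"

text \<open>Homomorphisms are required to be \<open>extensional\<close>, so that they are determined by their values on
  the arrows.\<close>

definition cocycles :: "('a, 'u) top_groupoid \<Rightarrow> ('a \<Rightarrow> int) set"
  where "cocycles \<G> =
    {\<xi> \<in> extensional (topspace (arrows \<G>)).
       continuous_map (arrows \<G>) (discrete_topology UNIV) \<xi> \<and>
       (\<forall>g\<in>topspace (arrows \<G>). \<forall>h\<in>topspace (arrows \<G>).
          source_map \<G> g = range_map \<G> h \<longrightarrow> \<xi> (arrow_comp \<G> g h) = \<xi> g + \<xi> h)}"

definition coboundaries :: "('a, 'u) top_groupoid \<Rightarrow> ('a \<Rightarrow> int) set"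
  where "coboundaries \<G> =
    {\<xi> \<in> cocycles \<G>. \<exists>f. continuous_map (unit_space \<G>) (discrete_topology UNIV) f \<and>
       (\<forall>g\<in>topspace (arrows \<G>). \<xi> g = f (range_map \<G> g) - f (source_map \<G> g))}"

definition cocycle_group :: "('a, 'u) top_groupoid \<Rightarrow> ('a \<Rightarrow> int) monoid"
  where "cocycle_group \<G> =
    \<lparr>carrier = cocycles \<G>,
     mult = (\<lambda>\<xi> \<eta>. \<lambda>g\<in>topspace (arrows \<G>). \<xi> g + \<eta> g),
     one = (\<lambda>g\<in>topspace (arrows \<G>). 0)\<rparr>"

definition H1 :: "('a, 'u) top_groupoid \<Rightarrow> ('a \<Rightarrow> int) set monoid"
  where "H1 \<G> = cocycle_group \<G> Mod coboundaries \<G>"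

text \<open>The map \<open>[\<xi>] \<mapsto> [\<xi> \<circ> \<pi>]\<close> from \<open>H1 \<H>\<close> to \<open>H1 \<G>\<close> induced by \<open>\<pi> : \<G> \<rightarrow> \<H>\<close>, written without a
  choice of representatives: all \<open>\<xi>\<close> in a class yield the same class in \<open>H1 \<G>\<close>.\<close>

definition H1_map ::
    "('a, 'u) top_groupoid \<Rightarrow> ('a \<Rightarrow> 'b) \<Rightarrow> ('b \<Rightarrow> int) set \<Rightarrow> ('a \<Rightarrow> int) set"
  where "H1_map \<G> \<pi> C =
    (\<Union>\<xi>\<in>C. coboundaries \<G> #>\<^bsub>cocycle_group \<G>\<^esub> restrict (\<xi> \<circ> \<pi>) (topspace (arrows \<G>)))"

text \<open>A discrete group as a groupoid with a single unit.\<close>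

definition group_groupoid :: "('g, 'm) monoid_scheme \<Rightarrow> ('g, 'g) top_groupoid"
  where "group_groupoid G =
    \<lparr>arrows = discrete_topology (carrier G),
     unit_space = discrete_topology {\<one>\<^bsub>G\<^esub>},
     range_map = (\<lambda>_. \<one>\<^bsub>G\<^esub>),
     source_map = (\<lambda>_. \<one>\<^bsub>G\<^esub>),
     arrow_comp = (\<lambda>g h. g \<otimes>\<^bsub>G\<^esub> h)\<rparr>"

definition transformation_groupoid ::
    "('g, 'm) monoid_scheme \<Rightarrow> 'x topology \<Rightarrow> ('g \<Rightarrow> 'x \<Rightarrow> 'x) \<Rightarrow> ('x \<times> 'g, 'x) top_groupoid"
  where "transformation_groupoid G X \<phi> =
    \<lparr>arrows = prod_topology X (discrete_topology (carrier G)),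
     unit_space = X,
     range_map = (\<lambda>(x, \<gamma>). x),
     source_map = (\<lambda>(x, \<gamma>). \<phi> (inv\<^bsub>G\<^esub> \<gamma>) x),
     arrow_comp = (\<lambda>(x, \<gamma>) (y, \<gamma>'). (x, \<gamma> \<otimes>\<^bsub>G\<^esub> \<gamma>'))\<rparr>"

text \<open>The projection \<open>\<pi> (x, \<gamma>) = \<gamma>\<close> is \<^const>\<open>snd\<close>.\<close>

definition H1_rigid ::
    "('g, 'm) monoid_scheme \<Rightarrow> 'x topology \<Rightarrow> ('g \<Rightarrow> 'x \<Rightarrow> 'x) \<Rightarrow> bool"
  where "H1_rigid G X \<phi> \<longleftrightarrow>
    H1_map (transformation_groupoid G X \<phi>) snd
      \<in> iso (H1 (group_groupoid G)) (H1 (transformation_groupoid G X \<phi>))"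


section \<open>Semidirect products with the integers\<close>

definition semidirect_int ::
    "('g, 'm) monoid_scheme \<Rightarrow> ('g \<Rightarrow> 'g) \<Rightarrow> ('g \<times> int) monoid"
  where "semidirect_int \<Gamma> \<theta> =
    \<lparr>carrier = carrier \<Gamma> \<times> UNIV,
     mult = (\<lambda>(a, m) (b, n). (a \<otimes>\<^bsub>\<Gamma>\<^esub> (\<theta> [^]\<^bsub>AutoGroup \<Gamma>\<^esub> m) b, m + n)),
     one = (\<one>\<^bsub>\<Gamma>\<^esub>, 0)\<rparr>"


section \<open>Well-definedness\<close>

lemma group_semidirect_int:
  assumes "group \<Gamma>" and "\<theta> \<in> carrier (AutoGroup \<Gamma>)"
  shows "group (semidirect_int \<Gamma> \<theta>)"
proof -
  interpret \<Gamma>: group \<Gamma> by fact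
  interpret A: group "AutoGroup \<Gamma>" by (rule \<Gamma>.AutoGroup)
  define p where "p m = \<theta> [^]\<^bsub>AutoGroup \<Gamma>\<^esub> (m::int)" for m
  have pc: "p m \<in> auto \<Gamma>" for m
    using A.int_pow_closed[OF assms(2), of m] by (simp add: p_def AutoGroup_def)
  have pcl: "p m a \<in> carrier \<Gamma>" if "a \<in> carrier \<Gamma>" for m a
    using pc[of m] that by (auto simp: auto_def hom_def)
  have pmult: "p m (a \<otimes>\<^bsub>\<Gamma>\<^esub> b) = p m a \<otimes>\<^bsub>\<Gamma>\<^esub> p m b"
    if "a \<in> carrier \<Gamma>" "b \<in> carrier \<Gamma>" for m a b
    using pc[of m] that by (auto simp: auto_def hom_def)
  have p0: "p 0 a = a" if "a \<in> carrier \<Gamma>" for a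
    using that by (simp add: p_def AutoGroup_def BijGroup_def)
  have padd: "p (m + n) a = p m (p n a)" if "a \<in> carrier \<Gamma>" for m n a
  proof -
    have "p (m + n) = p m \<otimes>\<^bsub>AutoGroup \<Gamma>\<^esub> p n"
      unfolding p_def by (rule A.int_pow_mult[OF assms(2)])
    moreover have "p m \<in> Bij (carrier \<Gamma>)" "p n \<in> Bij (carrier \<Gamma>)"
      using pc by (auto simp: auto_def)
    ultimately show ?thesis
      using that by (simp add: AutoGroup_def BijGroup_def compose_def)
  qed
  have eq: "semidirect_int \<Gamma> \<theta> = \<lparr>carrier = carrier \<Gamma> \<times> UNIV,
     mult = (\<lambda>(a, m) (b, n). (a \<otimes>\<^bsub>\<Gamma>\<^esub> p m b, m + n)), one = (\<one>\<^bsub>\<Gamma>\<^esub>, 0)\<rparr>"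
    by (simp add: semidirect_int_def p_def)
  show ?thesis
  proof (rule groupI)
    fix x assume "x \<in> carrier (semidirect_int \<Gamma> \<theta>)"
    then obtain a m where x: "x = (a, m)" "a \<in> carrier \<Gamma>" by (auto simp: eq)
    let ?y = "(p (- m) (inv\<^bsub>\<Gamma>\<^esub> a), - m)"
    have "p (-m) (inv\<^bsub>\<Gamma>\<^esub> a) \<otimes>\<^bsub>\<Gamma>\<^esub> p (-m) a = \<one>\<^bsub>\<Gamma>\<^esub>"
    proof -
      have "p (-m) \<one>\<^bsub>\<Gamma>\<^esub> \<otimes>\<^bsub>\<Gamma>\<^esub> p (-m) \<one>\<^bsub>\<Gamma>\<^esub> = p (-m) \<one>\<^bsub>\<Gamma>\<^esub>"
        using pmult[of "\<one>\<^bsub>\<Gamma>\<^esub>" "\<one>\<^bsub>\<Gamma>\<^esub>" "-m"] by simp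
      then have "p (-m) \<one>\<^bsub>\<Gamma>\<^esub> = \<one>\<^bsub>\<Gamma>\<^esub>" using pcl[of "\<one>\<^bsub>\<Gamma>\<^esub>" "-m"] by simp
      then show ?thesis using pmult[of "inv\<^bsub>\<Gamma>\<^esub> a" a "-m"] x by simp
    qed
    then show "\<exists>y\<in>carrier (semidirect_int \<Gamma> \<theta>).
        y \<otimes>\<^bsub>semidirect_int \<Gamma> \<theta>\<^esub> x = \<one>\<^bsub>semidirect_int \<Gamma> \<theta>\<^esub>"
      using x by (intro bexI[of _ ?y]) (auto simp: eq pcl)
  qed (auto simp: eq pcl pmult p0 padd \<Gamma>.m_assoc)
qed

lemma continuous_map_int_add:
  fixes \<xi> \<eta> :: "'a \<Rightarrow> int"
  assumes "continuous_map T (discrete_topology UNIV) \<xi>"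
    and "continuous_map T (discrete_topology UNIV) \<eta>"
  shows "continuous_map T (discrete_topology UNIV) (\<lambda>g. \<xi> g + \<eta> g)"
proof -
  have "continuous_map T (prod_topology (discrete_topology UNIV) (discrete_topology UNIV))
          (\<lambda>g. (\<xi> g, \<eta> g))"
    using assms by (simp add: continuous_map_paired)
  then have "continuous_map T (discrete_topology UNIV) (\<lambda>g. (\<xi> g, \<eta> g))"
    by (metis UNIV_Times_UNIV prod_topology_discrete_topology)
  then have "continuous_map T (discrete_topology UNIV) ((\<lambda>(a, b). a + b) \<circ> (\<lambda>g. (\<xi> g, \<eta> g)))"
    by (rule continuous_map_compose) simp
  then show ?thesis by (simp add: o_def)
qed

lemma continuous_map_int_uminus:
  fixes \<xi> :: "'a \<Rightarrow> int"
  assumes "continuous_map T (discrete_topology UNIV) \<xi>"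
  shows "continuous_map T (discrete_topology UNIV) (\<lambda>g. - \<xi> g)"
  using continuous_map_compose[OF assms, of "discrete_topology UNIV" uminus] by (simp add: o_def)

definition comp_closed :: "('a, 'u) top_groupoid \<Rightarrow> bool"
  where "comp_closed \<G> \<longleftrightarrow>
    (\<forall>g\<in>topspace (arrows \<G>). \<forall>h\<in>topspace (arrows \<G>).
       source_map \<G> g = range_map \<G> h \<longrightarrow> arrow_comp \<G> g h \<in> topspace (arrows \<G>))"

lemma comp_closed_group_groupoid: "group G \<Longrightarrow> comp_closed (group_groupoid G)"
  by (simp add: comp_closed_def group_groupoid_def group.is_monoid monoid.m_closed)

lemma comp_closed_transformation_groupoid:
  "group G \<Longrightarrow> comp_closed (transformation_groupoid G X \<phi>)"
  by (auto simp: comp_closed_def transformation_groupoid_def group.is_monoid monoid.m_closed)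

lemma restrict_mem_cocycles:
  assumes "comp_closed \<G>" and "continuous_map (arrows \<G>) (discrete_topology UNIV) c"
    and "\<And>g h. g \<in> topspace (arrows \<G>) \<Longrightarrow> h \<in> topspace (arrows \<G>) \<Longrightarrow>
           source_map \<G> g = range_map \<G> h \<Longrightarrow> c (arrow_comp \<G> g h) = c g + c h"
  shows "restrict c (topspace (arrows \<G>)) \<in> cocycles \<G>"
proof -
  have "continuous_map (arrows \<G>) (discrete_topology UNIV) (restrict c (topspace (arrows \<G>)))"
    using assms(2) by (rule continuous_map_eq) simp
  then show ?thesis using assms(1,3) by (auto simp: cocycles_def comp_closed_def)
qed

lemma
  assumes "comp_closed \<G>"
  shows cocycles_add: "\<xi> \<in> cocycles \<G> \<Longrightarrow> \<eta> \<in> cocycles \<G> \<Longrightarrow>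
      (\<lambda>g\<in>topspace (arrows \<G>). \<xi> g + \<eta> g) \<in> cocycles \<G>"
    and cocycles_uminus: "\<xi> \<in> cocycles \<G> \<Longrightarrow> (\<lambda>g\<in>topspace (arrows \<G>). - \<xi> g) \<in> cocycles \<G>"
    and cocycles_zero: "(\<lambda>g\<in>topspace (arrows \<G>). 0) \<in> cocycles \<G>"
proof -
  show "\<xi> \<in> cocycles \<G> \<Longrightarrow> \<eta> \<in> cocycles \<G> \<Longrightarrow>
      (\<lambda>g\<in>topspace (arrows \<G>). \<xi> g + \<eta> g) \<in> cocycles \<G>"
    by (rule restrict_mem_cocycles[OF assms]) (auto simp: cocycles_def intro: continuous_map_int_add)
  show "\<xi> \<in> cocycles \<G> \<Longrightarrow> (\<lambda>g\<in>topspace (arrows \<G>). - \<xi> g) \<in> cocycles \<G>"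
    by (rule restrict_mem_cocycles[OF assms]) (auto simp: cocycles_def intro: continuous_map_int_uminus)
  show "(\<lambda>g\<in>topspace (arrows \<G>). 0) \<in> cocycles \<G>"
    by (rule restrict_mem_cocycles[OF assms]) auto
qed

lemma comm_group_cocycle_group:
  assumes "comp_closed \<G>"
  shows "comm_group (cocycle_group \<G>)"
proof (rule comm_groupI)
  fix \<xi> assume "\<xi> \<in> carrier (cocycle_group \<G>)"
  then have x: "\<xi> \<in> cocycles \<G>" by (simp add: cocycle_group_def)
  show "\<exists>\<eta>\<in>carrier (cocycle_group \<G>). \<eta> \<otimes>\<^bsub>cocycle_group \<G>\<^esub> \<xi> = \<one>\<^bsub>cocycle_group \<G>\<^esub>"
    using cocycles_uminus[OF assms x]
    by (intro bexI[of _ "\<lambda>g\<in>topspace (arrows \<G>). - \<xi> g"]) (auto simp: cocycle_group_def)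
next
  fix \<xi> assume "\<xi> \<in> carrier (cocycle_group \<G>)"
  then have "\<xi> \<in> extensional (topspace (arrows \<G>))"
    by (simp add: cocycle_group_def cocycles_def)
  then show "\<one>\<^bsub>cocycle_group \<G>\<^esub> \<otimes>\<^bsub>cocycle_group \<G>\<^esub> \<xi> = \<xi>"
    by (auto simp: cocycle_group_def extensional_def restrict_def)
qed (auto simp: cocycle_group_def assms cocycles_add cocycles_zero add_ac cong: restrict_cong)

lemma inv_cocycle_group:
  assumes "comp_closed \<G>" and "\<xi> \<in> cocycles \<G>"
  shows "inv\<^bsub>cocycle_group \<G>\<^esub> \<xi> = (\<lambda>g\<in>topspace (arrows \<G>). - \<xi> g)"
proof -
  interpret comm_group "cocycle_group \<G>" by (rule comm_group_cocycle_group) fact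
  show ?thesis
    by (rule inv_equality)
      (use assms cocycles_uminus in \<open>auto simp: cocycle_group_def restrict_def\<close>)
qed

lemma normal_coboundaries:
  assumes "comp_closed \<G>"
  shows "coboundaries \<G> \<lhd> cocycle_group \<G>"
proof -
  interpret comm_group "cocycle_group \<G>" by (rule comm_group_cocycle_group) fact
  have "subgroup (coboundaries \<G>) (cocycle_group \<G>)"
  proof (rule subgroupI)
    have "(\<lambda>g\<in>topspace (arrows \<G>). 0) \<in> coboundaries \<G>"
      using cocycles_zero[OF assms] by (auto simp: coboundaries_def intro!: exI[of _ "\<lambda>_. 0"])
    then show "coboundaries \<G> \<noteq> {}" by blast
  next
    fix \<xi> assume a: "\<xi> \<in> coboundaries \<G>"
    then obtain f where "\<xi> \<in> cocycles \<G>" "continuous_map (unit_space \<G>) (discrete_topology UNIV) f"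
      "\<forall>g\<in>topspace (arrows \<G>). \<xi> g = f (range_map \<G> g) - f (source_map \<G> g)"
      by (auto simp: coboundaries_def)
    then show "inv\<^bsub>cocycle_group \<G>\<^esub> \<xi> \<in> coboundaries \<G>"
      using cocycles_uminus[OF assms] continuous_map_int_uminus
      by (auto simp: inv_cocycle_group[OF assms] coboundaries_def intro!: exI[of _ "\<lambda>u. - f u"])
  next
    fix \<xi> \<eta> assume "\<xi> \<in> coboundaries \<G>" "\<eta> \<in> coboundaries \<G>"
    then obtain f h where "\<xi> \<in> cocycles \<G>" "continuous_map (unit_space \<G>) (discrete_topology UNIV) f"
      "\<forall>g\<in>topspace (arrows \<G>). \<xi> g = f (range_map \<G> g) - f (source_map \<G> g)"
      "\<eta> \<in> cocycles \<G>" "continuous_map (unit_space \<G>) (discrete_topology UNIV) h"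
      "\<forall>g\<in>topspace (arrows \<G>). \<eta> g = h (range_map \<G> g) - h (source_map \<G> g)"
      by (auto simp: coboundaries_def)
    then show "\<xi> \<otimes>\<^bsub>cocycle_group \<G>\<^esub> \<eta> \<in> coboundaries \<G>"
      using cocycles_add[OF assms] continuous_map_int_add
      by (auto simp: cocycle_group_def coboundaries_def intro!: exI[of _ "\<lambda>u. f u + h u"])
  qed (auto simp: coboundaries_def cocycle_group_def)
  then show ?thesis by (rule subgroup_imp_normal)
qed

lemma comm_group_H1:
  assumes "comp_closed \<G>"
  shows "comm_group (H1 \<G>)"
  using comm_group.abelian_FactGroup[OF comm_group_cocycle_group[OF assms]]
    normal_imp_subgroup[OF normal_coboundaries[OF assms]]
  by (simp add: H1_def)

lemma cocycles_group_groupoid: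
  "cocycles (group_groupoid G) = hom G integer_group \<inter> extensional (carrier G)"
  by (auto simp: cocycles_def group_groupoid_def hom_def integer_group_def)

lemma coboundaries_group_groupoid:
  assumes "group G"
  shows "coboundaries (group_groupoid G) = {\<lambda>g\<in>carrier G. 0}"
proof -
  have "\<xi> = (\<lambda>g\<in>carrier G. 0)" if "\<xi> \<in> coboundaries (group_groupoid G)" for \<xi>
    using that by (auto simp: coboundaries_def cocycles_def group_groupoid_def extensional_def)
  moreover have "(\<lambda>g\<in>carrier G. 0) \<in> coboundaries (group_groupoid G)"
    using cocycles_zero[OF comp_closed_group_groupoid[OF assms]]
    by (auto simp: coboundaries_def group_groupoid_def intro!: exI[of _ "\<lambda>_. 0"])
  ultimately show ?thesis by blast
qed

lemma H1_map_class:
  assumes "group G" and "\<xi> \<in> cocycles (group_groupoid G)"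
  shows "H1_map \<G> \<pi> (coboundaries (group_groupoid G) #>\<^bsub>cocycle_group (group_groupoid G)\<^esub> \<xi>) =
    coboundaries \<G> #>\<^bsub>cocycle_group \<G>\<^esub> restrict (\<xi> \<circ> \<pi>) (topspace (arrows \<G>))"
proof -
  interpret comm_group "cocycle_group (group_groupoid G)"
    by (intro comm_group_cocycle_group comp_closed_group_groupoid assms)
  have "(\<lambda>g\<in>carrier G. 0) = \<one>\<^bsub>cocycle_group (group_groupoid G)\<^esub>"
    by (simp add: cocycle_group_def group_groupoid_def)
  moreover have "\<xi> \<in> carrier (cocycle_group (group_groupoid G))"
    using assms by (simp add: cocycle_group_def)
  ultimately have "coboundaries (group_groupoid G) #>\<^bsub>cocycle_group (group_groupoid G)\<^esub> \<xi> = {\<xi>}"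
    by (simp add: coboundaries_group_groupoid[OF assms(1)] r_coset_def)
  then show ?thesis by (simp add: H1_map_def)
qed

end

theory Submission
  imports Defs
begin

text \<open>Write \<open>G\<close> for the semidirect product and regard \<open>\<Gamma>\<close> as a normal subgroup of it. The argument
  rests on one principle: a continuous integer-valued function on \<open>X\<close> that is invariant under \<open>\<Gamma>\<close>
  is constant, because it is constant on a dense orbit (\<open>minimal_action_invariant_constant\<close>).

  Rigidity consists of two statements about cocycles (\<open>H1_rigid_iff\<close>): a homomorphism to the
  integers that becomes a coboundary on \<open>X\<close> vanishes, and every cocycle is a homomorphism plus a
  coboundary. For the first one, let \<open>h g = f x - f (g\<inverse> x)\<close> on \<open>G\<close>. Rigidity of \<open>\<Gamma>\<close> gives \<open>h = 0\<close>
  on \<open>\<Gamma>\<close>, so \<open>f\<close> is \<open>\<Gamma>\<close>-invariant, hence constant, and \<open>h = 0\<close>.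

  For the second one, let \<open>\<xi>\<close> be a cocycle of \<open>G\<close>. Rigidity of \<open>\<Gamma>\<close> permits subtracting a coboundary,
  after which \<open>\<xi> (x, n)\<close> is a homomorphism \<open>h n\<close> for \<open>n\<close> in \<open>\<Gamma>\<close>. For \<open>g\<close> in \<open>G\<close>, expanding \<open>\<xi>\<close> at both
  sides of \<open>n g = g (g\<inverse> n g)\<close> gives
  \<open>h n - h (g\<inverse> n g) = \<xi> (x, g) - \<xi> (n\<inverse> x, g)\<close>.
  The left side is a homomorphism in \<open>n\<close> and the right side a coboundary, so both vanish. Thus
  \<open>\<xi> (x, g)\<close> is \<open>\<Gamma>\<close>-invariant in \<open>x\<close>, hence independent of \<open>x\<close>, and the cocycle identity
  turns \<open>\<xi>\<close> into a homomorphism on \<open>G\<close>. The argument concerns normal subgroups in general and is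
  carried out in that form in \<open>H1_rigid_of_normal_image\<close>.\<close>

section \<open>Rigidity in terms of cocycles\<close>

lemma cocycles_transformation_groupoid:
  "\<xi> \<in> cocycles (transformation_groupoid G X \<phi>) \<longleftrightarrow>
     \<xi> \<in> extensional (topspace X \<times> carrier G) \<and>
     continuous_map (prod_topology X (discrete_topology (carrier G))) (discrete_topology UNIV) \<xi> \<and>
     (\<forall>x\<in>topspace X. \<forall>g\<in>carrier G. \<forall>k\<in>carrier G.
        \<phi> (inv\<^bsub>G\<^esub> g) x \<in> topspace X \<longrightarrow> \<xi> (x, g \<otimes>\<^bsub>G\<^esub> k) = \<xi> (x, g) + \<xi> (\<phi> (inv\<^bsub>G\<^esub> g) x, k))"
  by (auto simp: cocycles_def transformation_groupoid_def)

lemma coboundaries_transformation_groupoid: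
  "\<xi> \<in> coboundaries (transformation_groupoid G X \<phi>) \<longleftrightarrow>
     \<xi> \<in> cocycles (transformation_groupoid G X \<phi>) \<and>
     (\<exists>f. continuous_map X (discrete_topology UNIV) f \<and>
        (\<forall>x\<in>topspace X. \<forall>g\<in>carrier G. \<xi> (x, g) = f x - f (\<phi> (inv\<^bsub>G\<^esub> g) x)))"
  by (auto simp: coboundaries_def transformation_groupoid_def)

lemma pullback_cocycle:
  assumes "group G" and "h \<in> hom G integer_group"
  shows "restrict (h \<circ> snd) (topspace X \<times> carrier G) \<in> cocycles (transformation_groupoid G X \<phi>)"
proof -
  let ?\<G> = "transformation_groupoid G X \<phi>"
  have "continuous_map (prod_topology X (discrete_topology (carrier G))) (discrete_topology UNIV) (h \<circ> snd)"
    by (rule continuous_map_compose[OF continuous_map_snd]) simp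
  then have "restrict (h \<circ> snd) (topspace (arrows ?\<G>)) \<in> cocycles ?\<G>"
    using assms
    by (intro restrict_mem_cocycles comp_closed_transformation_groupoid)
      (auto simp: transformation_groupoid_def hom_def integer_group_def)
  then show ?thesis by (simp add: transformation_groupoid_def)
qed

text \<open>Since a group has a single unit, its coboundaries vanish, so each class in \<open>H1\<close> of the group
  is a singleton and the map on classes is determined by \<open>P\<close> in the proof, pulling a homomorphism
  back to a cocycle on \<open>X\<close>. The two conjuncts say that the kernel of the map is trivial and that the map is onto.\<close>

lemma H1_rigid_iff:
  assumes "group G"
  shows "H1_rigid G X \<phi> \<longleftrightarrow>
    (\<forall>h\<in>hom G integer_group. \<forall>f. continuous_map X (discrete_topology UNIV) f \<longrightarrow>
       (\<forall>x\<in>topspace X. \<forall>g\<in>carrier G. h g = f x - f (\<phi> (inv\<^bsub>G\<^esub> g) x)) \<longrightarrow>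
       (\<forall>g\<in>carrier G. h g = 0)) \<and>
    (\<forall>\<xi>\<in>cocycles (transformation_groupoid G X \<phi>).
       \<exists>h\<in>hom G integer_group. \<exists>f. continuous_map X (discrete_topology UNIV) f \<and>
         (\<forall>x\<in>topspace X. \<forall>g\<in>carrier G. \<xi> (x, g) = h g + (f x - f (\<phi> (inv\<^bsub>G\<^esub> g) x))))"
    (is "_ \<longleftrightarrow> ?inj \<and> ?surj")
proof -
  let ?T = "transformation_groupoid G X \<phi>" and ?K = "group_groupoid G"
  let ?A = "cocycle_group ?K" and ?B = "cocycle_group ?T"
  let ?D = "coboundaries ?T"
  let ?F = "H1_map ?T snd"
  define P where "P h = restrict (h \<circ> snd) (topspace X \<times> carrier G)" for h :: "'a \<Rightarrow> int"
  interpret A: comm_group ?A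
    by (intro comm_group_cocycle_group comp_closed_group_groupoid assms)
  interpret B: comm_group ?B
    by (intro comm_group_cocycle_group comp_closed_transformation_groupoid assms)
  have nD: "?D \<lhd> ?B" and nK: "coboundaries ?K \<lhd> ?A"
    by (intro normal_coboundaries comp_closed_transformation_groupoid comp_closed_group_groupoid assms)+
  interpret D: normal ?D ?B by (rule nD)
  have D: "subgroup ?D ?B" by (rule D.subgroup_axioms)
  interpret K: normal "coboundaries ?K" ?A by (rule nK)
  have cA: "carrier ?A = hom G integer_group \<inter> extensional (carrier G)"
    using cocycles_group_groupoid by (simp add: cocycle_group_def)
  have cB: "carrier ?B = cocycles ?T" by (simp add: cocycle_group_def)
  have arr: "topspace (arrows ?T) = topspace X \<times> carrier G" "topspace (arrows ?K) = carrier G"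
    by (simp_all add: transformation_groupoid_def group_groupoid_def)
  have Z: "coboundaries ?K = {\<one>\<^bsub>?A\<^esub>}"
    by (simp add: coboundaries_group_groupoid[OF assms] cocycle_group_def arr)
  have sing: "coboundaries ?K #>\<^bsub>?A\<^esub> h = {h}" if "h \<in> carrier ?A" for h
    using that by (simp add: Z r_coset_def)
  have F: "?F {h} = ?D #>\<^bsub>?B\<^esub> P h" if "h \<in> carrier ?A" for h
    using H1_map_class[OF assms, of h ?T snd] that sing[OF that]
    by (simp add: P_def arr cocycle_group_def)
  have PB: "P h \<in> carrier ?B" if "h \<in> hom G integer_group" for h
    unfolding cB P_def by (rule pullback_cocycle[OF assms that])
  \<comment> \<open>Elements of \<open>hom\<close> are arbitrary outside the carrier, so a class is represented by the restriction.\<close>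
  have Ares: "restrict h (carrier G) \<in> carrier ?A" if "h \<in> hom G integer_group" for h
    using that assms by (auto simp: cA hom_def group.is_monoid monoid.m_closed)
  have Pres: "P (restrict h (carrier G)) = P h" for h
    by (auto simp: P_def restrict_def)
  have Pmult: "P (h \<otimes>\<^bsub>?A\<^esub> k) = P h \<otimes>\<^bsub>?B\<^esub> P k" for h k
    by (auto simp: P_def cocycle_group_def arr restrict_def)
  have H1K: "carrier (H1 ?K) = (\<lambda>h. {h}) ` carrier ?A"
    by (auto simp: H1_def FactGroup_def RCOSETS_def sing)
  have H1T: "carrier (H1 ?T) = (\<lambda>\<xi>. ?D #>\<^bsub>?B\<^esub> \<xi>) ` carrier ?B"
    by (auto simp: H1_def FactGroup_def RCOSETS_def)
  have Fhom: "?F \<in> hom (H1 ?K) (H1 ?T)"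
  proof (rule homI)
    fix C assume "C \<in> carrier (H1 ?K)"
    then show "?F C \<in> carrier (H1 ?T)"
      using PB by (auto simp: H1K H1T F cA)
  next
    fix C E assume "C \<in> carrier (H1 ?K)" "E \<in> carrier (H1 ?K)"
    then obtain h k where hk: "C = {h}" "E = {k}" "h \<in> carrier ?A" "k \<in> carrier ?A"
      by (auto simp: H1K)
    then have m: "C \<otimes>\<^bsub>H1 ?K\<^esub> E = {h \<otimes>\<^bsub>?A\<^esub> k}"
      by (simp add: H1_def FactGroup_def set_mult_def)
    have "?F (C \<otimes>\<^bsub>H1 ?K\<^esub> E) = ?D #>\<^bsub>?B\<^esub> (P h \<otimes>\<^bsub>?B\<^esub> P k)"
      unfolding m F[OF A.m_closed[OF hk(3,4)]] Pmult ..
    also have "\<dots> = (?D #>\<^bsub>?B\<^esub> P h) <#>\<^bsub>?B\<^esub> (?D #>\<^bsub>?B\<^esub> P k)"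
      using hk PB by (simp add: D.rcos_sum cA)
    finally show "?F (C \<otimes>\<^bsub>H1 ?K\<^esub> E) = ?F C \<otimes>\<^bsub>H1 ?T\<^esub> ?F E"
      using hk by (simp add: F H1_def FactGroup_def)
  qed
  interpret F: group_hom "H1 ?K" "H1 ?T" ?F
    using Fhom comm_group_H1[OF comp_closed_group_groupoid[OF assms]]
      comm_group_H1[OF comp_closed_transformation_groupoid[OF assms]]
    by (intro group_hom.intro group_hom_axioms.intro comm_group.axioms(2))
  have PD: "P h \<in> ?D \<longleftrightarrow> (\<exists>f. continuous_map X (discrete_topology UNIV) f \<and>
        (\<forall>x\<in>topspace X. \<forall>g\<in>carrier G. h g = f x - f (\<phi> (inv\<^bsub>G\<^esub> g) x)))"
    if "h \<in> hom G integer_group" for h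
    using PB[OF that] unfolding coboundaries_transformation_groupoid cB by (simp add: P_def)
  have "inj_on ?F (carrier (H1 ?K)) \<longleftrightarrow>
      (\<forall>h\<in>carrier ?A. P h \<in> ?D \<longrightarrow> h = \<one>\<^bsub>?A\<^esub>)"
  proof -
    have k: "kernel (H1 ?K) (H1 ?T) ?F = {{h} |h. h \<in> carrier ?A \<and> P h \<in> ?D}"
    proof -
      have "?F {h} = \<one>\<^bsub>H1 ?T\<^esub> \<longleftrightarrow> P h \<in> ?D" if "h \<in> carrier ?A" for h
      proof -
        have Pc: "P h \<in> carrier ?B" using that PB by (simp add: cA)
        have "?D #>\<^bsub>?B\<^esub> P h = ?D \<longleftrightarrow> P h \<in> ?D"
          using B.coset_join1[OF _ Pc D] B.coset_join2[OF Pc D] by blast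
        then show ?thesis
          by (simp add: F[OF that]) (simp add: H1_def FactGroup_def)
      qed
      then show ?thesis by (auto simp: kernel_def H1K)
    qed
    have o: "\<one>\<^bsub>H1 ?K\<^esub> = {\<one>\<^bsub>?A\<^esub>}" by (simp add: H1_def FactGroup_def Z)
    have "P \<one>\<^bsub>?A\<^esub> \<in> ?D"
      using subgroup.one_closed[OF F.subgroup_kernel] unfolding k o by auto
    then show ?thesis unfolding F.inj_iff_trivial_ker k o by auto
  qed
  also have "\<dots> \<longleftrightarrow> (\<forall>h\<in>hom G integer_group. P h \<in> ?D \<longrightarrow> (\<forall>g\<in>carrier G. h g = 0))"
  proof safe
    fix h g assume a: "\<forall>h\<in>carrier ?A. P h \<in> ?D \<longrightarrow> h = \<one>\<^bsub>?A\<^esub>"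
      and h: "h \<in> hom G integer_group" "P h \<in> ?D" and g: "g \<in> carrier G"
    have "restrict h (carrier G) = \<one>\<^bsub>?A\<^esub>" using a h(2) Ares[OF h(1)] Pres by metis
    then show "h g = 0" using g by (simp add: cocycle_group_def arr) (metis restrict_apply')
  next
    fix h assume "\<forall>h\<in>hom G integer_group. P h \<in> ?D \<longrightarrow> (\<forall>g\<in>carrier G. h g = 0)"
      "h \<in> carrier ?A" "P h \<in> ?D"
    then have "h \<in> extensional (carrier G)" and "\<forall>g\<in>carrier G. h g = 0"
      unfolding cA by blast+
    then show "h = \<one>\<^bsub>?A\<^esub>" by (auto simp: cocycle_group_def arr extensional_def)
  qed
  also have "\<dots> \<longleftrightarrow> ?inj"
    by (intro ball_cong refl) (simp only: PD imp_conjL imp_ex)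
  finally have inj: "inj_on ?F (carrier (H1 ?K)) \<longleftrightarrow> ?inj" .
  have coset: "?D #>\<^bsub>?B\<^esub> \<xi> = ?D #>\<^bsub>?B\<^esub> P h \<longleftrightarrow>
      (\<exists>f. continuous_map X (discrete_topology UNIV) f \<and>
         (\<forall>x\<in>topspace X. \<forall>g\<in>carrier G. \<xi> (x, g) = h g + (f x - f (\<phi> (inv\<^bsub>G\<^esub> g) x))))"
    if \<xi>: "\<xi> \<in> carrier ?B" and h: "h \<in> hom G integer_group" for \<xi> h
  proof -
    let ?d = "\<xi> \<otimes>\<^bsub>?B\<^esub> inv\<^bsub>?B\<^esub> P h"
    have "?D #>\<^bsub>?B\<^esub> \<xi> = ?D #>\<^bsub>?B\<^esub> P h \<longleftrightarrow> \<xi> \<in> ?D #>\<^bsub>?B\<^esub> P h"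
      using B.rcos_self[OF \<xi> D] B.repr_independence[OF _ PB[OF h] D] by metis
    also have "\<dots> \<longleftrightarrow> ?d \<in> ?D"
      using D.rcos_module[OF B.is_group PB[OF h] \<xi>] .
    also have "\<dots> \<longleftrightarrow> (\<exists>f. continuous_map X (discrete_topology UNIV) f \<and>
         (\<forall>x\<in>topspace X. \<forall>g\<in>carrier G. ?d (x, g) = f x - f (\<phi> (inv\<^bsub>G\<^esub> g) x)))"
      using B.m_closed[OF \<xi> B.inv_closed[OF PB[OF h]]]
      unfolding coboundaries_transformation_groupoid cB by simp
    also have "\<dots> \<longleftrightarrow> (\<exists>f. continuous_map X (discrete_topology UNIV) f \<and>
         (\<forall>x\<in>topspace X. \<forall>g\<in>carrier G. \<xi> (x, g) = h g + (f x - f (\<phi> (inv\<^bsub>G\<^esub> g) x))))"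
    proof -
      have "?d (x, g) = \<xi> (x, g) - h g" if "x \<in> topspace X" "g \<in> carrier G" for x g
        using that PB[OF h] unfolding cB
        by (subst inv_cocycle_group[OF comp_closed_transformation_groupoid[OF assms]])
          (auto simp: cocycle_group_def arr P_def)
      then have "?d (x, g) = a \<longleftrightarrow> \<xi> (x, g) = h g + a"
        if "x \<in> topspace X" "g \<in> carrier G" for x g a
        using that by (simp add: diff_eq_eq add.commute)
      then show ?thesis by (simp cong: ball_cong)
    qed
    finally show ?thesis .
  qed
  have "?F ` carrier (H1 ?K) = carrier (H1 ?T) \<longleftrightarrow> carrier (H1 ?T) \<subseteq> ?F ` carrier (H1 ?K)"
    using F.hom_closed by blast
  also have "\<dots> \<longleftrightarrow> (\<forall>\<xi>\<in>carrier ?B. \<exists>h\<in>carrier ?A. ?D #>\<^bsub>?B\<^esub> \<xi> = ?D #>\<^bsub>?B\<^esub> P h)"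
    by (auto simp: H1K H1T F image_subset_iff image_iff)
  also have "\<dots> \<longleftrightarrow> (\<forall>\<xi>\<in>carrier ?B. \<exists>h\<in>hom G integer_group. ?D #>\<^bsub>?B\<^esub> \<xi> = ?D #>\<^bsub>?B\<^esub> P h)"
  proof (intro ball_cong refl iffI)
    fix \<xi> assume "\<exists>h\<in>hom G integer_group. ?D #>\<^bsub>?B\<^esub> \<xi> = ?D #>\<^bsub>?B\<^esub> P h"
    then obtain h where "h \<in> hom G integer_group" "?D #>\<^bsub>?B\<^esub> \<xi> = ?D #>\<^bsub>?B\<^esub> P h" by blast
    then show "\<exists>h\<in>carrier ?A. ?D #>\<^bsub>?B\<^esub> \<xi> = ?D #>\<^bsub>?B\<^esub> P h"
      using Ares by (intro bexI[of _ "restrict h (carrier G)"]) (simp_all add: Pres)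
  qed (auto simp: cA)
  also have "\<dots> \<longleftrightarrow> ?surj"
    unfolding cB[symmetric] by (simp add: coset cong: ball_cong bex_cong)
  finally have surj: "?F ` carrier (H1 ?K) = carrier (H1 ?T) \<longleftrightarrow> ?surj" .
  show ?thesis
    by (simp only: H1_rigid_def iso_def bij_betw_def mem_Collect_eq Fhom inj surj simp_thms)
qed

section \<open>Minimal normal restrictions\<close>

text \<open>The level set of \<open>f\<close> through \<open>y\<close> is closed, as the target is discrete, and contains the
  orbit of \<open>y\<close>, which is dense.\<close>

lemma minimal_action_invariant_constant:
  assumes min: "minimal_action G X \<phi>"
    and f: "continuous_map X (discrete_topology UNIV) f"
    and inv: "\<And>g x. g \<in> carrier G \<Longrightarrow> x \<in> topspace X \<Longrightarrow> f (\<phi> g x) = f x"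
    and orb: "\<And>g x. g \<in> carrier G \<Longrightarrow> x \<in> topspace X \<Longrightarrow> \<phi> g x \<in> topspace X"
    and xy: "x \<in> topspace X" "y \<in> topspace X"
  shows "f x = f y"
proof -
  have "closedin X {z \<in> topspace X. f z \<in> {f y}}"
    by (rule closedin_continuous_map_preimage[OF f]) simp
  moreover have "orbit G \<phi> y \<subseteq> {z \<in> topspace X. f z \<in> {f y}}"
    using inv orb xy by (auto simp: orbit_def)
  ultimately have "X closure_of (orbit G \<phi> y) \<subseteq> {z \<in> topspace X. f z \<in> {f y}}"
    by (rule closure_of_minimal[rotated])
  then show ?thesis using min xy by (auto simp: minimal_action_def)
qed

text \<open>Normality is what makes conjugation by \<open>g\<close> act on the image of \<open>N\<close>, so that, for a
  cocycle that is a homomorphism on \<open>N\<close>, its variation at \<open>g\<close> along the orbits of \<open>N\<close> does not depend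
  on the point and defines a homomorphism on \<open>N\<close>.\<close>

theorem H1_rigid_of_normal_image:
  assumes hom: "group_hom N G \<iota>" and normal: "\<iota> ` carrier N \<lhd> G"
    and act: "continuous_action G X \<phi>" and ne: "topspace X \<noteq> {}"
    and min: "minimal_action N X (\<lambda>n. \<phi> (\<iota> n))"
    and rigid: "H1_rigid N X (\<lambda>n. \<phi> (\<iota> n))"
  shows "H1_rigid G X \<phi>"
proof -
  interpret \<iota>: group_hom N G \<iota> by (rule hom)
  interpret \<iota>N: normal "\<iota> ` carrier N" G by (rule normal)
  interpret act: group_action G "topspace X" \<phi>
    using act by (simp add: continuous_action_def)
  have cont: "continuous_map X X (\<phi> g)" if "g \<in> carrier G" for g
    using act that by (simp add: continuous_action_def)
  have inX: "\<phi> g x \<in> topspace X" if "g \<in> carrier G" "x \<in> topspace X" for g x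
    using act.element_image that by blast
  have comp: "\<phi> (g \<otimes>\<^bsub>G\<^esub> k) x = \<phi> g (\<phi> k x)"
    if "g \<in> carrier G" "k \<in> carrier G" "x \<in> topspace X" for g k x
    using act.composition_rule that by blast
  have const: "f x = f y"
    if f: "continuous_map X (discrete_topology UNIV) f"
      and inv: "\<And>n z. n \<in> carrier N \<Longrightarrow> z \<in> topspace X \<Longrightarrow> f z - f (\<phi> (inv\<^bsub>G\<^esub> \<iota> n) z) = 0"
      and xy: "x \<in> topspace X" "y \<in> topspace X" for f :: "_ \<Rightarrow> int" and x y
  proof (rule minimal_action_invariant_constant[OF min f _ _ xy])
    fix n z assume "n \<in> carrier N" "z \<in> topspace X"
    then show "f (\<phi> (\<iota> n) z) = f z"
      using inv[of "inv\<^bsub>N\<^esub> n" z] by simp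
  qed (simp add: inX)
  have injN: "h n = 0"
    if "h \<in> hom N integer_group" "continuous_map X (discrete_topology UNIV) f"
      "\<And>x n. x \<in> topspace X \<Longrightarrow> n \<in> carrier N \<Longrightarrow> h n = f x - f (\<phi> (inv\<^bsub>G\<^esub> \<iota> n) x)"
      "n \<in> carrier N" for h f n
    using rigid that unfolding H1_rigid_iff[OF \<iota>.G.is_group] by simp
  show ?thesis
    unfolding H1_rigid_iff[OF \<iota>.H.is_group]
  proof (intro conjI ballI allI impI)
    fix h f g
    assume h: "h \<in> hom G integer_group" and f: "continuous_map X (discrete_topology UNIV) f"
      and hf: "\<forall>x\<in>topspace X. \<forall>g\<in>carrier G. h g = f x - f (\<phi> (inv\<^bsub>G\<^esub> g) x)"
      and g: "g \<in> carrier G"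
    have "h \<circ> \<iota> \<in> hom N integer_group"
      using hom_compose[OF \<iota>.homh h] .
    then have hN: "h (\<iota> n) = 0" if "n \<in> carrier N" for n
      using injN[OF _ f, of "h \<circ> \<iota>" n] hf that by simp
    obtain x where x: "x \<in> topspace X" using ne by blast
    have "f x = f (\<phi> (inv\<^bsub>G\<^esub> g) x)"
      by (rule const[OF f]) (use hf hN x g inX in auto)
    then show "h g = 0" using hf x g by simp
  next
    fix \<xi> assume \<xi>: "\<xi> \<in> cocycles (transformation_groupoid G X \<phi>)"
    have \<xi>c: "continuous_map (prod_topology X (discrete_topology (carrier G))) (discrete_topology UNIV) \<xi>"
      and \<xi>m: "\<And>x g k. x \<in> topspace X \<Longrightarrow> g \<in> carrier G \<Longrightarrow> k \<in> carrier G \<Longrightarrow>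
          \<xi> (x, g \<otimes>\<^bsub>G\<^esub> k) = \<xi> (x, g) + \<xi> (\<phi> (inv\<^bsub>G\<^esub> g) x, k)"
      using \<xi> inX by (auto simp: cocycles_transformation_groupoid)
    let ?\<xi>N = "restrict (\<lambda>(x, n). \<xi> (x, \<iota> n)) (topspace X \<times> carrier N)"
    have "?\<xi>N \<in> cocycles (transformation_groupoid N X (\<lambda>n. \<phi> (\<iota> n)))"
    proof -
      have "continuous_map (prod_topology X (discrete_topology (carrier N)))
          (prod_topology X (discrete_topology (carrier G))) (\<lambda>(x, n). (x, \<iota> n))"
        unfolding case_prod_beta
        by (intro continuous_map_pairedI continuous_map_fst
            continuous_map_compose[OF continuous_map_snd, unfolded o_def]) auto
      from continuous_map_compose[OF this \<xi>c]
      have "continuous_map (prod_topology X (discrete_topology (carrier N))) (discrete_topology UNIV) ?\<xi>N"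
        by (rule continuous_map_eq) auto
      then show ?thesis
        unfolding cocycles_transformation_groupoid by (auto simp: \<xi>m)
    qed
    then obtain h f where h: "h \<in> hom N integer_group"
      and f: "continuous_map X (discrete_topology UNIV) f"
      and hf: "\<And>x n. x \<in> topspace X \<Longrightarrow> n \<in> carrier N \<Longrightarrow>
          \<xi> (x, \<iota> n) = h n + (f x - f (\<phi> (inv\<^bsub>G\<^esub> \<iota> n) x))"
      using rigid unfolding H1_rigid_iff[OF \<iota>.G.is_group] by fastforce
    \<comment> \<open>The function cohomologous to \<open>\<xi>\<close> that agrees on \<open>N\<close> with the homomorphism \<open>h\<close>.\<close>
    define c where "c x g = \<xi> (x, g) - (f x - f (\<phi> (inv\<^bsub>G\<^esub> g) x))" for x g
    have cN: "c x (\<iota> n) = h n" if "x \<in> topspace X" "n \<in> carrier N" for x n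
      using that by (simp add: c_def hf)
    have cm: "c x (g \<otimes>\<^bsub>G\<^esub> k) = c x g + c (\<phi> (inv\<^bsub>G\<^esub> g) x) k"
      if "x \<in> topspace X" "g \<in> carrier G" "k \<in> carrier G" for x g k
      using that by (simp add: c_def \<xi>m \<iota>.H.inv_mult_group comp)
    have cc: "continuous_map X (discrete_topology UNIV) (\<lambda>x. c x g)" if g: "g \<in> carrier G" for g
    proof -
      have "continuous_map X (prod_topology X (discrete_topology (carrier G))) (\<lambda>x. (x, g))"
        using g by (simp add: continuous_map_paired)
      from continuous_map_compose[OF this \<xi>c]
      have 1: "continuous_map X (discrete_topology UNIV) (\<lambda>x. \<xi> (x, g))" by (simp add: o_def)
      have 2: "continuous_map X (discrete_topology UNIV) (\<lambda>x. f (\<phi> (inv\<^bsub>G\<^esub> g) x))"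
        using continuous_map_compose[OF cont f, of "inv\<^bsub>G\<^esub> g"] g by (simp add: o_def)
      show ?thesis
        using continuous_map_int_add[OF continuous_map_int_add[OF 1 continuous_map_int_uminus[OF f]] 2]
        by (simp add: c_def algebra_simps)
    qed
    obtain x0 where x0: "x0 \<in> topspace X" using ne by blast
    have c_const: "c x g = c x0 g" if g: "g \<in> carrier G" and x: "x \<in> topspace X" for g x
    proof -
      define u where "u n = inv\<^bsub>G\<^esub> g \<otimes>\<^bsub>G\<^esub> \<iota> n \<otimes>\<^bsub>G\<^esub> g" for n
      have uN: "u n \<in> \<iota> ` carrier N" if "n \<in> carrier N" for n
        unfolding u_def using \<iota>N.inv_op_closed1[OF g] that by blast
      have uG: "u n \<in> carrier G" if "n \<in> carrier N" for n
        using g that by (simp add: u_def)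
      have cu: "c z (u n) = c x0 (u n)" if "z \<in> topspace X" "n \<in> carrier N" for z n
        using uN[OF that(2)] cN that x0 by auto
      have um: "u (n \<otimes>\<^bsub>N\<^esub> m) = u n \<otimes>\<^bsub>G\<^esub> u m" if "n \<in> carrier N" "m \<in> carrier N" for n m
      proof -
        have "g \<otimes>\<^bsub>G\<^esub> (inv\<^bsub>G\<^esub> g \<otimes>\<^bsub>G\<^esub> y) = y" if "y \<in> carrier G" for y
          using that g by (simp add: \<iota>.H.m_assoc[symmetric])
        then show ?thesis using that g by (simp add: u_def \<iota>.H.m_assoc)
      qed
      \<comment> \<open>\<open>h\<close> minus its conjugate by \<open>g\<close>. The conjugate is written through \<open>c\<close>, which spares a choice
        of preimages of the \<open>u n\<close> under \<open>\<iota>\<close>.\<close>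
      define d where "d n = h n - c x0 (u n)" for n
      have d: "d n = c z g - c (\<phi> (inv\<^bsub>G\<^esub> \<iota> n) z) g" if "z \<in> topspace X" "n \<in> carrier N" for z n
      proof -
        have "\<iota> n \<otimes>\<^bsub>G\<^esub> g = g \<otimes>\<^bsub>G\<^esub> u n"
          using that g by (simp add: u_def \<iota>.H.m_assoc[symmetric])
        then have "c z (\<iota> n) + c (\<phi> (inv\<^bsub>G\<^esub> \<iota> n) z) g = c z g + c (\<phi> (inv\<^bsub>G\<^esub> g) z) (u n)"
          using cm[of z "\<iota> n" g] cm[of z g "u n"] that g uG by simp
        then show ?thesis
          using that g cu[of "\<phi> (inv\<^bsub>G\<^esub> g) z" n] inX by (simp add: d_def cN)
      qed
      have "d \<in> hom N integer_group"
      proof (rule homI)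
        fix n m assume nm: "n \<in> carrier N" "m \<in> carrier N"
        have "c x0 (u (n \<otimes>\<^bsub>N\<^esub> m)) = c x0 (u n) + c x0 (u m)"
          using cm[of x0 "u n" "u m"] cu[of "\<phi> (inv\<^bsub>G\<^esub> u n) x0" m] nm uG inX x0
          by (simp add: um)
        then show "d (n \<otimes>\<^bsub>N\<^esub> m) = d n \<otimes>\<^bsub>integer_group\<^esub> d m"
          using h nm by (simp add: d_def hom_def)
      qed simp
      then have "d n = 0" if "n \<in> carrier N" for n
        using injN[where h = d and f = "\<lambda>z. c z g"] cc[OF g] d that by metis
      then show ?thesis
        using d by (intro const[OF cc[OF g] _ x x0]) metis
    qed
    have "c x0 \<in> hom G integer_group"
    proof (rule homI)
      fix g k assume gk: "g \<in> carrier G" "k \<in> carrier G"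
      then show "c x0 (g \<otimes>\<^bsub>G\<^esub> k) = c x0 g \<otimes>\<^bsub>integer_group\<^esub> c x0 k"
        using cm[OF x0 gk] c_const[OF gk(2), of "\<phi> (inv\<^bsub>G\<^esub> g) x0"] inX x0 by simp
    qed simp
    moreover have "\<xi> (x, g) = c x0 g + (f x - f (\<phi> (inv\<^bsub>G\<^esub> g) x))"
      if "x \<in> topspace X" "g \<in> carrier G" for x g
      using c_const[of g x] that by (simp add: c_def)
    ultimately show "\<exists>h\<in>hom G integer_group. \<exists>f. continuous_map X (discrete_topology UNIV) f \<and>
        (\<forall>x\<in>topspace X. \<forall>g\<in>carrier G. \<xi> (x, g) = h g + (f x - f (\<phi> (inv\<^bsub>G\<^esub> g) x)))"
      using f by blast
  qed
qed

section \<open>Semidirect products\<close>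

text \<open>The copy of \<open>\<Gamma>\<close> is normal as the kernel of the projection to the integers.\<close>

lemma semidirect_int_embedding:
  assumes "group \<Gamma>" and "\<theta> \<in> carrier (AutoGroup \<Gamma>)"
  shows "group_hom \<Gamma> (semidirect_int \<Gamma> \<theta>) (\<lambda>\<gamma>. (\<gamma>, 0))"
    and "(\<lambda>\<gamma>. (\<gamma>, 0)) ` carrier \<Gamma> \<lhd> semidirect_int \<Gamma> \<theta>"
proof -
  interpret \<Gamma>: group \<Gamma> by fact
  interpret G: group "semidirect_int \<Gamma> \<theta>" by (rule group_semidirect_int) fact+
  show "group_hom \<Gamma> (semidirect_int \<Gamma> \<theta>) (\<lambda>\<gamma>. (\<gamma>, 0))"
    by unfold_locales (auto simp: hom_def semidirect_int_def AutoGroup_def BijGroup_def)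
  interpret p: group_hom "semidirect_int \<Gamma> \<theta>" integer_group snd
    by (intro group_hom.intro group_hom_axioms.intro G.is_group group_integer_group)
      (auto simp: hom_def semidirect_int_def)
  have "kernel (semidirect_int \<Gamma> \<theta>) integer_group snd = (\<lambda>\<gamma>. (\<gamma>, 0)) ` carrier \<Gamma>"
    by (auto simp: kernel_def semidirect_int_def)
  then show "(\<lambda>\<gamma>. (\<gamma>, 0)) ` carrier \<Gamma> \<lhd> semidirect_int \<Gamma> \<theta>"
    using p.normal_kernel by simp
qed

theorem proposition2p10:
  fixes \<Gamma> :: "('g, 'm) monoid_scheme"
    and \<theta> :: "'g \<Rightarrow> 'g"
    and X :: "'x topology"
    and \<phi> :: "'g \<times> int \<Rightarrow> 'x \<Rightarrow> 'x"
  assumes "group \<Gamma>" and "countable (carrier \<Gamma>)"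
    and "\<theta> \<in> carrier (AutoGroup \<Gamma>)"
    and "topspace X \<noteq> {}" and "totally_disconnected_space X"
    and "locally_compact_space X" and "Hausdorff_space X"
    and "continuous_action (semidirect_int \<Gamma> \<theta>) X \<phi>"
    and "minimal_action \<Gamma> X (\<lambda>\<gamma>. \<phi> (\<gamma>, 0))"
    and "H1_rigid \<Gamma> X (\<lambda>\<gamma>. \<phi> (\<gamma>, 0))"
  shows "H1_rigid (semidirect_int \<Gamma> \<theta>) X \<phi>"
  using H1_rigid_of_normal_image[OF semidirect_int_embedding[OF assms(1,3)] assms(8,4,9,10)] .

end
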